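(* Let $\Gamma$ be a discrete group, $\mathcal{G}$ a $\Gamma$-graded ample Hausdorff groupoid, $R$ a commutative ring with identity $1\ne0$, and $U$ an invariant subset of $\mathcal{G}^{(0)}$. Then $U$ is a $\Gamma$-aperiodic orbit if and only if $RU$ is a graded basic simple $A_R(\mathcal{G})$-module. Furthermore, $RU$ is a graded basic simple $A_R(\mathcal{G})$-module if and only if it is graded and basic simple.
   Context: For $x$ in a groupoid $\mathcal{G}$, $d(x)=x^{-1}x$, $r(x)=xx^{-1}$; $\mathcal{G}^{(0)}$ is the unit space. A compact open bisection is a compact open $B\subseteq\mathcal{G}$ on which $d$ and $r$ are homeomorphisms onto open subsets of $\mathcal{G}^{(0)}$. $\mathcal{G}$ is ample if it is a topological groupoid whose domain map is a local homeomorphism and which has a basis of compact open bisections. A $\Gamma$-grading is a continuous $c:\mathcal{G}\to\Gamma$ with $c(xy)=c(x)c(y)$ for composable $x,y$; $\varepsilon$ is the identity of $\Gamma$. $A_R(\mathcal{G})$ is the $R$-span of characteristic functions $1_B:\mathcal{G}\to R$ of compact open bisections, with convolution $(f*g)(z)=\sum_{xy=z}f(x)g(y)$, graded by $A_R(\mathcal{G})_\gamma=\{f:\operatorname{supp} f\subseteq c^{-1}(\gamma)\}$. $U\subseteq\mathcal{G}^{(0)}$ is invariant if $d(x)\in U$ implies $r(x)\in U$. For $u\in\mathcal{G}^{(0)}$, $[u]=r(d^{-1}(u))$ is the smallest invariant subset containing $u$; sets of this form are called orbits. $\mathrm{Iso}(u)=\{x\in\mathcal{G}:d(x)=r(x)=u\}$.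 A unit $u$ is $\Gamma$-aperiodic if $\mathrm{Iso}(u)\subseteq c^{-1}(\varepsilon)$; an invariant set is $\Gamma$-aperiodic if all its elements are. For $U$ invariant, $RU$ is the free $R$-module with basis $U$; it is a left $A_R(\mathcal{G})$-module in which, for a compact open bisection $B$ and $u\in U$, $1_B\cdot u=r(b)$ if $b\in B$ has $d(b)=u$, and $1_B\cdot u=0$ if $u\notin d(B)$. "$RU$ is graded" means that $RU$ admits a decomposition $RU=\bigoplus_{\gamma\in\Gamma}(RU)_\gamma$ into $R$-submodules with $A_R(\mathcal{G})_\alpha(RU)_\gamma\subseteq(RU)_{\alpha\gamma}$. A basic submodule of $RU$ is an $A_R(\mathcal{G})$-submodule $V$ such that $ru\in V$ with $r\in R\setminus\{0\}$, $u\in U$ implies $u\in V$. $RU$ is basic simple if it is nonzero and has no basic submodules other than $0$ and $RU$; it is graded basic simple if it is nonzero, graded (for some decomposition $RU=\bigoplus_{\gamma\in\Gamma}(RU)_\gamma$ into $R$-submodules with $A_R(\mathcal{G})_\alpha(RU)_\gamma\subseteq(RU)_{\alpha\gamma}$ for all $\alpha,\gamma\in\Gamma$), and has no graded basic submodules other than $0$ and $RU$. *)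

theory Defs
  imports "HOL-Analysis.Analysis" "HOL-Library.Poly_Mapping"
begin

section \<open>Ample groupoids\<close>

text \<open>The groupoid is carried by the underlying set of \<open>gtop\<close>. The product \<open>gmult\<close> is a total
  function that is meaningful only on the set \<open>composable\<close> of composable pairs.\<close>

record 'g groupoid_data =
  gtop :: "'g topology"
  composable :: "('g \<times> 'g) set"
  gmult :: "'g \<Rightarrow> 'g \<Rightarrow> 'g"
  ginv :: "'g \<Rightarrow> 'g"

definition arrows :: "'g groupoid_data \<Rightarrow> 'g set" where
  "arrows G = topspace (gtop G)"

definition gdom :: "'g groupoid_data \<Rightarrow> 'g \<Rightarrow> 'g" where
  "gdom G x = gmult G (ginv G x) x"

definition gran :: "'g groupoid_data \<Rightarrow> 'g \<Rightarrow> 'g" where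
  "gran G x = gmult G x (ginv G x)"

definition units :: "'g groupoid_data \<Rightarrow> 'g set" where
  "units G = gdom G ` arrows G"

text \<open>The algebraic axioms are those of Hahn and Renault; composability turns out to be
  \<open>d x = r y\<close>, see \<open>composable_iff\<close> below.\<close>

locale groupoid =
  fixes G :: "'g groupoid_data"
  assumes composable_subset: "composable G \<subseteq> arrows G \<times> arrows G"
    and mult_closed: "(x, y) \<in> composable G \<Longrightarrow> gmult G x y \<in> arrows G"
    and inv_closed: "x \<in> arrows G \<Longrightarrow> ginv G x \<in> arrows G"
    and inv_inv: "x \<in> arrows G \<Longrightarrow> ginv G (ginv G x) = x"
    and assoc_left: "(x, y) \<in> composable G \<Longrightarrow> (y, z) \<in> composable G \<Longrightarrow>
          (gmult G x y, z) \<in> composable G"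
    and assoc_right: "(x, y) \<in> composable G \<Longrightarrow> (y, z) \<in> composable G \<Longrightarrow>
          (x, gmult G y z) \<in> composable G"
    and assoc: "(x, y) \<in> composable G \<Longrightarrow> (y, z) \<in> composable G \<Longrightarrow>
          gmult G (gmult G x y) z = gmult G x (gmult G y z)"
    and inv_composable: "x \<in> arrows G \<Longrightarrow> (ginv G x, x) \<in> composable G"
    and cancel_left: "(x, y) \<in> composable G \<Longrightarrow> gmult G (ginv G x) (gmult G x y) = y"
    and cancel_right: "(x, y) \<in> composable G \<Longrightarrow> gmult G (gmult G x y) (ginv G y) = x"

locale topological_groupoid = groupoid +
  assumes continuous_mult:
      "continuous_map (subtopology (prod_topology (gtop G) (gtop G)) (composable G)) (gtop G)
         (\<lambda>(x, y). gmult G x y)"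
    and continuous_inv: "continuous_map (gtop G) (gtop G) (ginv G)"

text \<open>\<open>p\<close> maps \<open>B\<close> homeomorphically onto an open subset of the unit space.\<close>

definition homeo_onto_open_units :: "'g groupoid_data \<Rightarrow> ('g \<Rightarrow> 'g) \<Rightarrow> 'g set \<Rightarrow> bool" where
  "homeo_onto_open_units G p B \<longleftrightarrow>
     openin (subtopology (gtop G) (units G)) (p ` B) \<and>
     homeomorphic_map (subtopology (gtop G) B) (subtopology (gtop G) (p ` B)) p"

definition compact_open_bisection :: "'g groupoid_data \<Rightarrow> 'g set \<Rightarrow> bool" where
  "compact_open_bisection G B \<longleftrightarrow>
     compactin (gtop G) B \<and> openin (gtop G) B \<and>
     homeo_onto_open_units G (gdom G) B \<and> homeo_onto_open_units G (gran G) B"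

locale ample_groupoid = topological_groupoid +
  assumes dom_local_homeo: "x \<in> arrows G \<Longrightarrow>
      \<exists>V. openin (gtop G) V \<and> x \<in> V \<and> homeo_onto_open_units G (gdom G) V"
    and bisection_basis: "openin (gtop G) W \<Longrightarrow> x \<in> W \<Longrightarrow>
      \<exists>B. compact_open_bisection G B \<and> x \<in> B \<and> B \<subseteq> W"

text \<open>The grading group is written additively but is not assumed to be commutative; its identity
  is \<open>0\<close>. It carries the discrete topology.\<close>

definition groupoid_grading :: "'g groupoid_data \<Rightarrow> ('g \<Rightarrow> 'c::group_add) \<Rightarrow> bool" where
  "groupoid_grading G c \<longleftrightarrow>
     continuous_map (gtop G) (discrete_topology UNIV) c \<and>
     (\<forall>(x, y) \<in> composable G. c (gmult G x y) = c x + c y)"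

definition invariant_set :: "'g groupoid_data \<Rightarrow> 'g set \<Rightarrow> bool" where
  "invariant_set G U \<longleftrightarrow> U \<subseteq> units G \<and> (\<forall>x \<in> arrows G. gdom G x \<in> U \<longrightarrow> gran G x \<in> U)"

definition orbit_of :: "'g groupoid_data \<Rightarrow> 'g \<Rightarrow> 'g set" where
  "orbit_of G u = gran G ` {x \<in> arrows G. gdom G x = u}"

definition is_orbit :: "'g groupoid_data \<Rightarrow> 'g set \<Rightarrow> bool" where
  "is_orbit G U \<longleftrightarrow> (\<exists>u \<in> units G. U = orbit_of G u)"

definition Iso :: "'g groupoid_data \<Rightarrow> 'g \<Rightarrow> 'g set" where
  "Iso G u = {x \<in> arrows G. gdom G x = u \<and> gran G x = u}"

definition aperiodic_unit :: "'g groupoid_data \<Rightarrow> ('g \<Rightarrow> 'c::group_add) \<Rightarrow> 'g \<Rightarrow> bool" where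
  "aperiodic_unit G c u \<longleftrightarrow> (\<forall>x \<in> Iso G u. c x = 0)"

definition aperiodic_set :: "'g groupoid_data \<Rightarrow> ('g \<Rightarrow> 'c::group_add) \<Rightarrow> 'g set \<Rightarrow> bool" where
  "aperiodic_set G c U \<longleftrightarrow> (\<forall>u \<in> U. aperiodic_unit G c u)"


section \<open>The Steinberg algebra\<close>

text \<open>Elements of the algebra are functions on the whole type that vanish off \<open>arrows G\<close>.\<close>

definition steinberg_algebra :: "'g groupoid_data \<Rightarrow> ('g \<Rightarrow> 'r::comm_ring_1) set" where
  "steinberg_algebra G =
     {f. \<exists>F a. finite F \<and> (\<forall>B \<in> F. compact_open_bisection G B) \<and>
               f = (\<lambda>x. \<Sum>B\<in>F. a B * indicator B x)}"

text \<open>On the Steinberg algebra the summation below is finite, see \<open>finite_conv\<close>. That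
  \<open>free_mod\<close> below is a left module for this product is \<open>act_convolution\<close>.\<close>

definition convolution ::
    "'g groupoid_data \<Rightarrow> ('g \<Rightarrow> 'r::comm_ring_1) \<Rightarrow> ('g \<Rightarrow> 'r) \<Rightarrow> 'g \<Rightarrow> 'r" where
  "convolution G f g z =
     (\<Sum>(x, y) | (x, y) \<in> composable G \<and> gmult G x y = z \<and> f x \<noteq> 0 \<and> g y \<noteq> 0. f x * g y)"

definition steinberg_component ::
    "'g groupoid_data \<Rightarrow> ('g \<Rightarrow> 'c) \<Rightarrow> 'c \<Rightarrow> ('g \<Rightarrow> 'r::comm_ring_1) set" where
  "steinberg_component G c \<gamma> =
     {f \<in> steinberg_algebra G. {x. f x \<noteq> 0} \<subseteq> {x \<in> arrows G. c x = \<gamma>}}"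


section \<open>The module RU\<close>

text \<open>Finitely supported functions; the basis element \<open>u\<close> is \<open>Poly_Mapping.single u 1\<close>, and
  \<open>r u\<close> is \<open>Poly_Mapping.single u r\<close>.\<close>

definition free_mod :: "'g set \<Rightarrow> ('g \<Rightarrow>\<^sub>0 'r::comm_ring_1) set" where
  "free_mod U = {m. Poly_Mapping.keys m \<subseteq> U}"

definition rscale :: "'r::comm_ring_1 \<Rightarrow> ('g \<Rightarrow>\<^sub>0 'r) \<Rightarrow> ('g \<Rightarrow>\<^sub>0 'r)" where
  "rscale r m = Poly_Mapping.map (\<lambda>a. r * a) m"

lemma lookup_rscale [simp]: "Poly_Mapping.lookup (rscale r m) u = r * Poly_Mapping.lookup m u"
  by (simp add: rscale_def map.rep_eq when_def)

lemma module_rscale: "module rscale"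
  by standard (auto intro!: poly_mapping_eqI simp: lookup_add algebra_simps)

text \<open>The bilinear extension of the action of \<open>1\<^sub>B\<close> on \<open>u\<close>:
  an arrow \<open>x\<close> with \<open>d x = u\<close> moves \<open>u\<close> to \<open>r x\<close> with weight \<open>f x\<close>.
  See \<open>act_bisection\<close> for the defining values, and \<open>act_add\<close>, \<open>act_scale\<close>, \<open>act_add_left\<close>,
  \<open>act_scale_left\<close> for bilinearity.\<close>

definition act ::
    "'g groupoid_data \<Rightarrow> ('g \<Rightarrow> 'r::comm_ring_1) \<Rightarrow> ('g \<Rightarrow>\<^sub>0 'r) \<Rightarrow> ('g \<Rightarrow>\<^sub>0 'r)" where
  "act G f m =
     (\<Sum>u \<in> Poly_Mapping.keys m. \<Sum>x | x \<in> arrows G \<and> gdom G x = u \<and> f x \<noteq> 0.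
        Poly_Mapping.single (gran G x) (f x * Poly_Mapping.lookup m u))"

definition direct_sum_decomp :: "'m::ab_group_add set \<Rightarrow> ('c \<Rightarrow> 'm set) \<Rightarrow> bool" where
  "direct_sum_decomp V M \<longleftrightarrow>
     (\<forall>\<gamma>. M \<gamma> \<subseteq> V) \<and>
     (\<forall>v \<in> V. \<exists>!h. finite {\<gamma>. h \<gamma> \<noteq> 0} \<and> (\<forall>\<gamma>. h \<gamma> \<in> M \<gamma>) \<and> v = (\<Sum>\<gamma> | h \<gamma> \<noteq> 0. h \<gamma>))"

definition module_grading ::
    "'g groupoid_data \<Rightarrow> ('g \<Rightarrow> 'c::group_add) \<Rightarrow> 'g set \<Rightarrow> ('c \<Rightarrow> ('g \<Rightarrow>\<^sub>0 'r::comm_ring_1) set) \<Rightarrow> bool"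
  where
  "module_grading G c U M \<longleftrightarrow>
     (\<forall>\<gamma>. module.subspace rscale (M \<gamma>)) \<and>
     direct_sum_decomp (free_mod U) M \<and>
     (\<forall>\<alpha> \<gamma>. \<forall>f \<in> steinberg_component G c \<alpha>. \<forall>m \<in> M \<gamma>. act G f m \<in> M (\<alpha> + \<gamma>))"

text \<open>The ring \<open>R\<close> enters the following notions only through its type, passed as \<open>TYPE('r)\<close>.\<close>

definition graded_module ::
    "'g groupoid_data \<Rightarrow> ('g \<Rightarrow> 'c::group_add) \<Rightarrow> 'g set \<Rightarrow> 'r::comm_ring_1 itself \<Rightarrow> bool" where
  "graded_module G c U R \<longleftrightarrow> (\<exists>M :: 'c \<Rightarrow> ('g \<Rightarrow>\<^sub>0 'r) set. module_grading G c U M)"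

definition submodule :: "'g groupoid_data \<Rightarrow> 'g set \<Rightarrow> ('g \<Rightarrow>\<^sub>0 'r::comm_ring_1) set \<Rightarrow> bool" where
  "submodule G U V \<longleftrightarrow>
     V \<subseteq> free_mod U \<and> 0 \<in> V \<and> (\<forall>v \<in> V. \<forall>w \<in> V. v + w \<in> V) \<and> (\<forall>v \<in> V. - v \<in> V) \<and>
     (\<forall>f \<in> steinberg_algebra G. \<forall>v \<in> V. act G f v \<in> V)"

definition basic_submodule ::
    "'g groupoid_data \<Rightarrow> 'g set \<Rightarrow> ('g \<Rightarrow>\<^sub>0 'r::comm_ring_1) set \<Rightarrow> bool" where
  "basic_submodule G U V \<longleftrightarrow>
     submodule G U V \<and>
     (\<forall>r u. r \<noteq> 0 \<longrightarrow> u \<in> U \<longrightarrow> Poly_Mapping.single u r \<in> V \<longrightarrow> Poly_Mapping.single u 1 \<in> V)"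

text \<open>Homogeneity of a submodule with respect to a decomposition \<open>M\<close> of the ambient module.\<close>

definition graded_subset :: "('c \<Rightarrow> 'm::ab_group_add set) \<Rightarrow> 'm set \<Rightarrow> bool" where
  "graded_subset M V \<longleftrightarrow> direct_sum_decomp V (\<lambda>\<gamma>. V \<inter> M \<gamma>)"

definition basic_simple :: "'g groupoid_data \<Rightarrow> 'g set \<Rightarrow> 'r::comm_ring_1 itself \<Rightarrow> bool" where
  "basic_simple G U R \<longleftrightarrow>
     (free_mod U :: ('g \<Rightarrow>\<^sub>0 'r) set) \<noteq> {0} \<and>
     (\<forall>V :: ('g \<Rightarrow>\<^sub>0 'r) set. basic_submodule G U V \<longrightarrow> V = {0} \<or> V = free_mod U)"

definition graded_basic_simple ::
    "'g groupoid_data \<Rightarrow> ('g \<Rightarrow> 'c::group_add) \<Rightarrow> 'g set \<Rightarrow> 'r::comm_ring_1 itself \<Rightarrow> bool" where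
  "graded_basic_simple G c U R \<longleftrightarrow>
     (free_mod U :: ('g \<Rightarrow>\<^sub>0 'r) set) \<noteq> {0} \<and>
     (\<exists>M :: 'c \<Rightarrow> ('g \<Rightarrow>\<^sub>0 'r) set. module_grading G c U M \<and>
        (\<forall>V. basic_submodule G U V \<and> graded_subset M V \<longrightarrow> V = {0} \<or> V = free_mod U))"


section \<open>The action is a module action\<close>

context groupoid
begin

lemma inv_composable': "x \<in> arrows G \<Longrightarrow> (x, ginv G x) \<in> composable G"
  using inv_composable[of "ginv G x"] inv_closed inv_inv by auto

lemma composable_dom_ran: "(x, y) \<in> composable G \<Longrightarrow> gdom G x = gran G y"
proof -
  assume a: "(x, y) \<in> composable G"
  then have x: "x \<in> arrows G" and y: "y \<in> arrows G" using composable_subset by auto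
  have "(ginv G x, gmult G x y) \<in> composable G"
    using assoc_right[OF inv_composable[OF x] a] .
  have "gmult G (ginv G x) x = gmult G (ginv G x) (gmult G (gmult G x y) (ginv G y))"
    using cancel_right[OF a] by simp
  also have "\<dots> = gmult G (gmult G (ginv G x) (gmult G x y)) (ginv G y)"
    using assoc[OF \<open>(ginv G x, gmult G x y) \<in> composable G\<close> assoc_left[OF a inv_composable'[OF y]]]
    by simp
  also have "\<dots> = gmult G y (ginv G y)" using cancel_left[OF a] by simp
  finally show ?thesis by (simp add: gdom_def gran_def)
qed

lemma composable_iff: 
  "(x, y) \<in> composable G \<longleftrightarrow> x \<in> arrows G \<and> y \<in> arrows G \<and> gdom G x = gran G y"
proof
  assume "(x, y) \<in> composable G"
  then show "x \<in> arrows G \<and> y \<in> arrows G \<and> gdom G x = gran G y"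
    using composable_subset composable_dom_ran by auto
next
  assume a: "x \<in> arrows G \<and> y \<in> arrows G \<and> gdom G x = gran G y"
  then have x: "(x, gdom G x) \<in> composable G"
    unfolding gdom_def using assoc_right inv_composable inv_composable' by blast
  have y: "(gran G y, y) \<in> composable G"
    unfolding gran_def using a assoc_left inv_composable inv_composable' by blast
  have "gmult G x (gdom G x) = x"
    using a assoc[OF inv_composable' inv_composable, of x] cancel_right[OF inv_composable', of x]
    by (simp add: gdom_def inv_inv)
  then show "(x, y) \<in> composable G" using assoc_left[OF x] y a by simp
qed

lemma ran_mult: assumes "(x, y) \<in> composable G" shows "gran G (gmult G x y) = gran G x"
proof -
  have x: "x \<in> arrows G" using assms composable_subset by auto
  have "(gran G x, x) \<in> composable G"
    unfolding gran_def using assoc_left inv_composable inv_composable' x by blast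
  from composable_dom_ran[OF this] composable_dom_ran[OF assoc_right[OF this assms]]
  show ?thesis by simp
qed

lemma dom_mult: assumes "(x, y) \<in> composable G" shows "gdom G (gmult G x y) = gdom G y"
proof -
  have y: "y \<in> arrows G" using assms composable_subset by auto
  from composable_dom_ran[OF inv_composable'[OF y]]
    composable_dom_ran[OF assoc_left[OF assms inv_composable'[OF y]]]
  show ?thesis by simp
qed

lemma bisection_inj:
  assumes "compact_open_bisection G B"
  shows "B \<subseteq> arrows G" "inj_on (gdom G) B"
proof -
  show B: "B \<subseteq> arrows G"
    using assms openin_subset by (auto simp: compact_open_bisection_def arrows_def)
  show "inj_on (gdom G) B"
    using assms B
    by (auto simp: compact_open_bisection_def homeo_onto_open_units_def homeomorphic_map_def
        arrows_def Int_absorb1)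
qed

lemma finite_fiber:
  assumes "f \<in> steinberg_algebra G"
  shows "finite {x \<in> arrows G. gdom G x = u \<and> f x \<noteq> 0}"
proof -
  obtain F a where F: "finite F" "\<And>B. B \<in> F \<Longrightarrow> compact_open_bisection G B"
      and f: "f = (\<lambda>x. \<Sum>B\<in>F. a B * indicator B x)"
    using assms by (auto simp: steinberg_algebra_def)
  have "{x \<in> arrows G. gdom G x = u \<and> f x \<noteq> 0} \<subseteq> (\<Union>B\<in>F. {x \<in> B. gdom G x = u})"
  proof
    fix x assume x: "x \<in> {x \<in> arrows G. gdom G x = u \<and> f x \<noteq> 0}"
    then obtain B where "B \<in> F" "a B * indicator B x \<noteq> 0"
      unfolding f by (auto elim: sum.not_neutral_contains_not_neutral)
    then show "x \<in> (\<Union>B\<in>F. {x \<in> B. gdom G x = u})"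
      using x by (cases "x \<in> B") auto
  qed
  moreover have "finite {x \<in> B. gdom G x = u}" if "B \<in> F" for B
    by (rule inj_on_finite[where f = "gdom G" and B = "{u}"])
      (use bisection_inj[OF F(2)[OF that]] in \<open>auto intro: inj_on_subset\<close>)
  ultimately show ?thesis using F(1) finite_subset by blast
qed

lemma act_superset:
  assumes "f \<in> steinberg_algebra G" "finite S" "Poly_Mapping.keys m \<subseteq> S"
  shows "act G f m = (\<Sum>u\<in>S. \<Sum>x | x \<in> arrows G \<and> gdom G x = u \<and> f x \<noteq> 0.
            Poly_Mapping.single (gran G x) (f x * Poly_Mapping.lookup m u))"
  unfolding act_def
  by (rule sum.mono_neutral_left) (use assms in \<open>auto simp: in_keys_iff\<close>)

lemma act_add:
  assumes "f \<in> steinberg_algebra G"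
  shows "act G f (m + n) = act G f m + act G f n"
proof -
  define S where "S = Poly_Mapping.keys m \<union> Poly_Mapping.keys n"
  have S: "finite S" "Poly_Mapping.keys m \<subseteq> S" "Poly_Mapping.keys n \<subseteq> S"
      "Poly_Mapping.keys (m + n) \<subseteq> S"
    using Poly_Mapping.keys_add[of m n] by (auto simp: S_def)
  show ?thesis
    unfolding act_superset[OF assms S(1,2)] act_superset[OF assms S(1,3)]
      act_superset[OF assms S(1,4)]
    by (simp add: sum.distrib[symmetric] lookup_add distrib_left single_add)
qed

lemma act_scale:
  fixes f :: "'g \<Rightarrow> 'r::comm_ring_1"
  assumes "f \<in> steinberg_algebra G"
  shows "act G f (rscale r m) = rscale r (act G f m)"
proof -
  have 1: "rscale r (sum h A) = (\<Sum>a\<in>A. rscale r (h a))"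
    for h :: "'x \<Rightarrow> 'y \<Rightarrow>\<^sub>0 'r" and A
    by (rule poly_mapping_eqI) (simp add: lookup_sum sum_distrib_left)
  have 2: "rscale r (Poly_Mapping.single u a) = Poly_Mapping.single u (r * a)" for u :: 'y and a
    by (rule poly_mapping_eqI) (simp add: lookup_single when_def)
  have "Poly_Mapping.keys (rscale r m) \<subseteq> Poly_Mapping.keys m"
    by (auto simp: in_keys_iff)
  then have "act G f (rscale r m) =
      (\<Sum>u\<in>Poly_Mapping.keys m. \<Sum>x | x \<in> arrows G \<and> gdom G x = u \<and> f x \<noteq> 0.
         Poly_Mapping.single (gran G x) (f x * (r * Poly_Mapping.lookup m u)))"
    by (subst act_superset[OF assms finite_keys]) auto
  also have "\<dots> = rscale r (act G f m)"
    unfolding act_def 1 2 by (simp add: mult.left_commute)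
  finally show ?thesis .
qed

lemma steinberg_add:
  assumes "f \<in> steinberg_algebra G" "g \<in> steinberg_algebra G"
  shows "(\<lambda>x. f x + g x) \<in> steinberg_algebra G"
proof -
  obtain F a where F: "finite F" "\<forall>B \<in> F. compact_open_bisection G B"
      and f: "f = (\<lambda>x. \<Sum>B\<in>F. a B * indicator B x)"
    using assms by (auto simp: steinberg_algebra_def)
  obtain H b where H: "finite H" "\<forall>B \<in> H. compact_open_bisection G B"
      and g: "g = (\<lambda>x. \<Sum>B\<in>H. b B * indicator B x)"
    using assms by (auto simp: steinberg_algebra_def)
  define d where "d B = (if B \<in> F then a B else 0) + (if B \<in> H then b B else 0)" for B
  have "f x = (\<Sum>B\<in>F \<union> H. (if B \<in> F then a B else 0) * indicator B x)" for x
    unfolding f by (rule sum.mono_neutral_cong_left) (use F(1) H(1) in auto)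
  moreover have "g x = (\<Sum>B\<in>F \<union> H. (if B \<in> H then b B else 0) * indicator B x)" for x
    unfolding g by (rule sum.mono_neutral_cong_left) (use F(1) H(1) in auto)
  ultimately have "(\<lambda>x. f x + g x) = (\<lambda>x. \<Sum>B\<in>F \<union> H. d B * indicator B x)"
    by (simp add: d_def distrib_right sum.distrib)
  then show ?thesis
    unfolding steinberg_algebra_def using F H by blast
qed

lemma act_add_left:
  assumes f: "f \<in> steinberg_algebra G" and g: "g \<in> steinberg_algebra G"
  shows "act G (\<lambda>x. f x + g x) m = act G f m + act G g m"
  unfolding act_def sum.distrib[symmetric]
proof (rule sum.cong[OF refl])
  fix u
  define X where "X = {x \<in> arrows G. gdom G x = u \<and> f x \<noteq> 0} \<union>
                      {x \<in> arrows G. gdom G x = u \<and> g x \<noteq> 0}"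
  have X: "finite X" unfolding X_def using finite_fiber f g by blast
  have *: "(\<Sum>x | x \<in> arrows G \<and> gdom G x = u \<and> h x \<noteq> 0.
              Poly_Mapping.single (gran G x) (h x * Poly_Mapping.lookup m u)) =
           (\<Sum>x\<in>X. Poly_Mapping.single (gran G x) (h x * Poly_Mapping.lookup m u))"
    if "{x \<in> arrows G. gdom G x = u \<and> h x \<noteq> 0} \<subseteq> X" for h
    by (rule sum.mono_neutral_left) (use X that in \<open>auto simp: X_def\<close>)
  show "(\<Sum>x | x \<in> arrows G \<and> gdom G x = u \<and> f x + g x \<noteq> 0.
           Poly_Mapping.single (gran G x) ((f x + g x) * Poly_Mapping.lookup m u)) =
        (\<Sum>x | x \<in> arrows G \<and> gdom G x = u \<and> f x \<noteq> 0.
           Poly_Mapping.single (gran G x) (f x * Poly_Mapping.lookup m u)) +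
        (\<Sum>x | x \<in> arrows G \<and> gdom G x = u \<and> g x \<noteq> 0.
           Poly_Mapping.single (gran G x) (g x * Poly_Mapping.lookup m u))"
    by (subst (1 2 3) *) (auto simp: X_def distrib_right single_add sum.distrib)
qed

lemma act_scale_left:
  fixes f :: "'g \<Rightarrow> 'r::comm_ring_1"
  assumes f: "f \<in> steinberg_algebra G"
  shows "act G (\<lambda>x. r * f x) m = rscale r (act G f m)"
proof -
  have 1: "rscale r (sum h A) = (\<Sum>a\<in>A. rscale r (h a))"
    for h :: "'x \<Rightarrow> 'y \<Rightarrow>\<^sub>0 'r" and A
    by (rule poly_mapping_eqI) (simp add: lookup_sum sum_distrib_left)
  have 2: "rscale r (Poly_Mapping.single u a) = Poly_Mapping.single u (r * a)" for u :: 'y and a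
    by (rule poly_mapping_eqI) (simp add: lookup_single when_def)
  show ?thesis
    unfolding act_def 1 2
  proof (rule sum.cong[OF refl], rule sum.mono_neutral_cong_left[OF finite_fiber[OF f]])
    fix u
    show "\<forall>x \<in> {x \<in> arrows G. gdom G x = u \<and> f x \<noteq> 0} -
             {x \<in> arrows G. gdom G x = u \<and> r * f x \<noteq> 0}.
           Poly_Mapping.single (gran G x) (r * (f x * Poly_Mapping.lookup m u)) = 0"
      by (simp add: mult.assoc[symmetric])
  qed (auto simp: mult.assoc)
qed

lemma act_single:
  "act G f (Poly_Mapping.single u a) =
     (\<Sum>x | x \<in> arrows G \<and> gdom G x = u \<and> f x \<noteq> 0. Poly_Mapping.single (gran G x) (f x * a))"
  by (cases "a = 0") (simp_all add: act_def)

lemma act_bisection: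
  assumes B: "compact_open_bisection G B"
  shows "b \<in> B \<Longrightarrow> gdom G b = u \<Longrightarrow>
           act G (indicator B) (Poly_Mapping.single u (1::'r::comm_ring_1)) =
           Poly_Mapping.single (gran G b) 1"
    and "u \<notin> gdom G ` B \<Longrightarrow> act G (indicator B) (Poly_Mapping.single u (1::'r)) = 0"
proof -
  have *: "{x \<in> arrows G. gdom G x = u \<and> (indicator B x :: 'r) \<noteq> 0} = {x \<in> B. gdom G x = u}"
    using bisection_inj(1)[OF B] by (auto simp: indicator_def split: if_splits)
  show "act G (indicator B) (Poly_Mapping.single u (1::'r)) = Poly_Mapping.single (gran G b) 1"
    if "b \<in> B" "gdom G b = u"
  proof -
    have "{x \<in> B. gdom G x = u} = {b}"
      using bisection_inj(2)[OF B] that by (auto dest: inj_onD)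
    then show ?thesis using that(1) unfolding act_single * by simp
  qed
  show "act G (indicator B) (Poly_Mapping.single u (1::'r)) = 0" if "u \<notin> gdom G ` B"
  proof -
    have "{x \<in> B. gdom G x = u} = {}" using that by auto
    then show ?thesis unfolding act_single * by (simp only: sum.empty)
  qed
qed

lemma act_sum:
  assumes "f \<in> steinberg_algebra G"
  shows "act G f (\<Sum>i\<in>I. m i) = (\<Sum>i\<in>I. act G f (m i))"
proof (induction I rule: infinite_finite_induct)
  case (insert i I)
  then show ?case by (simp add: act_add[OF assms])
qed (simp_all add: act_def)

lemma act_free_mod:
  fixes f :: "'g \<Rightarrow> 'r::comm_ring_1"
  assumes "invariant_set G U" "m \<in> free_mod U"
  shows "act G f m \<in> free_mod U"
proof -
  have sum: "sum h A \<in> free_mod U" if "\<And>a. a \<in> A \<Longrightarrow> h a \<in> free_mod U"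
    for A and h :: "'x \<Rightarrow> 'g \<Rightarrow>\<^sub>0 'r"
    using that
  proof (induction A rule: infinite_finite_induct)
    case (insert x A)
    then show ?case
      using Poly_Mapping.keys_add[of "h x" "sum h A"] by (auto simp: free_mod_def)
  qed (auto simp: free_mod_def)
  show ?thesis
    unfolding act_def
    by (intro sum) (use assms in \<open>auto simp: free_mod_def invariant_set_def\<close>)
qed

text \<open>The factorisations \<open>z = x y\<close> contributing to \<open>f * g\<close> over a fixed source \<open>u\<close>.\<close>

lemma finite_conv:
  assumes f: "f \<in> steinberg_algebra G" and g: "g \<in> steinberg_algebra G"
  shows "finite {(x, y). (x, y) \<in> composable G \<and> gdom G y = u \<and> f x \<noteq> 0 \<and> g y \<noteq> 0}"
proof (rule finite_subset)
  show "{(x, y). (x, y) \<in> composable G \<and> gdom G y = u \<and> f x \<noteq> 0 \<and> g y \<noteq> 0} \<subseteq>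
    (\<lambda>(y, x). (x, y)) ` (SIGMA y : {y \<in> arrows G. gdom G y = u \<and> g y \<noteq> 0}.
        {x \<in> arrows G. gdom G x = gran G y \<and> f x \<noteq> 0})"
    by (force simp: composable_iff)
qed (intro finite_imageI finite_SigmaI finite_fiber f g)

lemma act_convolution:
  fixes f g :: "'g \<Rightarrow> 'r::comm_ring_1"
  assumes f: "f \<in> steinberg_algebra G" and g: "g \<in> steinberg_algebra G"
  shows "act G (convolution G f g) m = act G f (act G g m)"
proof -
  let ?s = Poly_Mapping.single
  have "(\<Sum>z | z \<in> arrows G \<and> gdom G z = u \<and> convolution G f g z \<noteq> 0.
           ?s (gran G z) (convolution G f g z * a)) =
        (\<Sum>y | y \<in> arrows G \<and> gdom G y = u \<and> g y \<noteq> 0. act G f (?s (gran G y) (g y * a)))"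
    (is "?L = ?R") for u a
  proof -
    define P where
      "P = {(x, y). (x, y) \<in> composable G \<and> gdom G y = u \<and> f x \<noteq> 0 \<and> g y \<noteq> 0}"
    define Z where "Z = (\<lambda>(x, y). gmult G x y) ` P"
    have P: "finite P" unfolding P_def by (rule finite_conv[OF f g])
    have fibre: "{p \<in> P. (\<lambda>(x, y). gmult G x y) p = z} =
        {(x, y). (x, y) \<in> composable G \<and> gmult G x y = z \<and> f x \<noteq> 0 \<and> g y \<noteq> 0}"
      if "gdom G z = u" for z
      using that dom_mult by (auto simp: P_def)
    have Z: "z \<in> arrows G" "gdom G z = u" if "z \<in> Z" for z
      using that mult_closed dom_mult by (auto simp: Z_def P_def)
    have conv: "convolution G f g z =
        (\<Sum>(x, y) \<in> {p \<in> P. (\<lambda>(x, y). gmult G x y) p = z}. f x * g y)" if "gdom G z = u" for z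
      unfolding convolution_def fibre[OF that] by simp
    have "?L = (\<Sum>z\<in>Z. ?s (gran G z) (convolution G f g z * a))"
    proof (rule sum.mono_neutral_left)
      show "finite Z" using P by (simp add: Z_def)
      show "{z \<in> arrows G. gdom G z = u \<and> convolution G f g z \<noteq> 0} \<subseteq> Z"
      proof
        fix z assume z: "z \<in> {z \<in> arrows G. gdom G z = u \<and> convolution G f g z \<noteq> 0}"
        then have "gdom G z = u" "convolution G f g z \<noteq> 0" by simp_all
        then have "{p \<in> P. (\<lambda>(x, y). gmult G x y) p = z} \<noteq> {}"
          unfolding conv[OF \<open>gdom G z = u\<close>] by (metis sum.empty)
        then show "z \<in> Z" unfolding Z_def by blast
      qed
    qed (use Z in auto)
    also have "\<dots> = (\<Sum>z\<in>Z. \<Sum>(x, y) \<in> {p \<in> P. (\<lambda>(x, y). gmult G x y) p = z}.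
                       ?s (gran G x) (f x * g y * a))"
    proof (rule sum.cong[OF refl])
      fix z assume z: "z \<in> Z"
      have s: "?s v (sum h A * a) = (\<Sum>i\<in>A. ?s v (h i * a))"
        for v and h :: "'g \<times> 'g \<Rightarrow> 'r" and A
        by (rule poly_mapping_eqI) (simp add: lookup_single lookup_sum when_def sum_distrib_right)
      show "?s (gran G z) (convolution G f g z * a) =
          (\<Sum>(x, y) \<in> {p \<in> P. (\<lambda>(x, y). gmult G x y) p = z}. ?s (gran G x) (f x * g y * a))"
        unfolding conv[OF Z(2)[OF z]] s
        by (rule sum.cong[OF refl]) (auto simp: P_def ran_mult)
    qed
    also have "\<dots> = (\<Sum>(x, y)\<in>P. ?s (gran G x) (f x * g y * a))"
      unfolding Z_def by (rule sum.image_gen[OF P, symmetric])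
    also have "\<dots> = (\<Sum>(y, x) \<in> (SIGMA y : {y \<in> arrows G. gdom G y = u \<and> g y \<noteq> 0}.
        {x \<in> arrows G. gdom G x = gran G y \<and> f x \<noteq> 0}). ?s (gran G x) (f x * g y * a))"
      by (rule sum.reindex_bij_witness[where i = prod.swap and j = prod.swap])
        (auto simp: P_def composable_iff)
    also have "\<dots> = ?R"
      unfolding act_single
      by (subst sum.Sigma[symmetric]) (auto simp: finite_fiber f g mult.assoc)
    finally show ?thesis .
  qed
  then show ?thesis
    unfolding act_def[of G "convolution G f g"] act_def[of G g] act_sum[OF f] by simp
qed

end

end

theory Submission
  imports Defs
begin

text \<open>In a Hausdorff ample groupoid, every arrow \<open>x\<close> and every \<open>m \<in> RU\<close> admit a compact open
  bisection around \<open>x\<close>, inside the degree \<open>c x\<close>, whose sources meet the support of \<open>m\<close> at most in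
  \<open>d x\<close>. Its indicator extracts from \<open>m\<close> the coefficient at \<open>d x\<close> and moves it to \<open>r x\<close>
  (\<open>transport\<close>). With \<open>x\<close> a unit this shows that the components of any grading of \<open>RU\<close> are
  spanned by multiples of basis elements, so the span of an orbit is always a graded basic
  submodule; with \<open>x\<close> in the isotropy at \<open>u\<close> it puts a nonzero multiple of \<open>u\<close> into two components
  unless \<open>c x = 0\<close>. Conversely, on an aperiodic orbit the degree of an arrow from a fixed base
  point depends only on its range, and grades \<open>RU\<close>.\<close>

section \<open>Free modules on sets of basis elements, and direct sums\<close>

lemma free_mod_sum:
  "(\<And>a. a \<in> A \<Longrightarrow> h a \<in> free_mod S) \<Longrightarrow> sum h A \<in> free_mod S"
  using Poly_Mapping.keys_sum[of h A] by (fastforce simp: free_mod_def)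

lemma single_in_free_mod [simp]:
  "Poly_Mapping.single u r \<in> free_mod S \<longleftrightarrow> r = 0 \<or> u \<in> S"
  by (auto simp: free_mod_def)

lemma subspace_free_mod: "module.subspace rscale (free_mod S)"
proof (unfold module.subspace_def[OF module_rscale], intro conjI ballI allI)
  show "v + w \<in> free_mod S" if "v \<in> free_mod S" "w \<in> free_mod S" for v w
    using that Poly_Mapping.keys_add[of v w] unfolding free_mod_def by blast
  show "rscale r v \<in> free_mod S" if "v \<in> free_mod S" for r v
    using that by (force simp: free_mod_def in_keys_iff)
qed (simp add: free_mod_def)

text \<open>Since 1 \<noteq> 0 in the coefficient ring, \<open>Poly_Mapping.single u 1\<close> has
  support exactly \<open>{u}\<close>. This lets equalities of free submodules be read back as
  equalities of sets of units.\<close>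

lemma free_mod_subsetD:
  assumes "(free_mod S :: ('g \<Rightarrow>\<^sub>0 'r::comm_ring_1) set) \<subseteq> free_mod T"
  shows "S \<subseteq> T"
proof
  fix u assume "u \<in> S"
  then have "Poly_Mapping.single u (1::'r) \<in> free_mod S" by simp
  then have "Poly_Mapping.single u (1::'r) \<in> free_mod T" using assms by blast
  then show "u \<in> T" by simp
qed

lemma free_mod_eq_0_iff:
  "(free_mod S :: ('g \<Rightarrow>\<^sub>0 'r::comm_ring_1) set) = {0} \<longleftrightarrow> S = {}"
proof
  assume "(free_mod S :: ('g \<Rightarrow>\<^sub>0 'r) set) = {0}"
  then have "free_mod S \<subseteq> (free_mod {} :: ('g \<Rightarrow>\<^sub>0 'r) set)"
    by (simp add: free_mod_def)
  then show "S = {}" using free_mod_subsetD by blast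
qed (auto simp: free_mod_def)

lemma direct_sum_unique:
  assumes "direct_sum_decomp V M" "v \<in> V"
    and "finite {\<gamma>. h \<gamma> \<noteq> 0}" "\<And>\<gamma>. h \<gamma> \<in> M \<gamma>" "v = (\<Sum>\<gamma> | h \<gamma> \<noteq> 0. h \<gamma>)"
    and "finite {\<gamma>. k \<gamma> \<noteq> 0}" "\<And>\<gamma>. k \<gamma> \<in> M \<gamma>" "v = (\<Sum>\<gamma> | k \<gamma> \<noteq> 0. k \<gamma>)"
  shows "h = k"
  using assms unfolding direct_sum_decomp_def by blast

text \<open>A nonzero common element would have two decompositions, one concentrated at
  \<open>\<alpha>\<close> and one at \<open>\<beta>\<close>.\<close>

lemma direct_sum_disjoint:
  assumes M: "direct_sum_decomp V M" "\<And>\<gamma>. 0 \<in> M \<gamma>"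
    and v: "v \<in> M \<alpha>" "v \<in> M \<beta>" "\<alpha> \<noteq> \<beta>"
  shows "v = 0"
proof (rule ccontr)
  assume "v \<noteq> 0"
  have "v \<in> V" using M(1) v(1) by (auto simp: direct_sum_decomp_def)
  then have "(\<lambda>\<gamma>. if \<gamma> = \<alpha> then v else 0) = (\<lambda>\<gamma>. if \<gamma> = \<beta> then v else 0)"
    by (rule direct_sum_unique[OF M(1)]) (use M(2) v \<open>v \<noteq> 0\<close> in auto)
  then show False using \<open>v \<noteq> 0\<close> v(3) by (auto dest: fun_cong[of _ _ \<alpha>])
qed

text \<open>Splitting the basis into the fibres of \<open>deg\<close> splits the free module. This
  is the source of the grading built on an aperiodic orbit.\<close>

lemma direct_sum_free_mod_fibres:
  fixes deg :: "'g \<Rightarrow> 'c"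
  shows "direct_sum_decomp (free_mod U :: ('g \<Rightarrow>\<^sub>0 'r::comm_ring_1) set)
           (\<lambda>\<gamma>. free_mod {u \<in> U. deg u = \<gamma>})"
proof -
  let ?M = "\<lambda>\<gamma>. free_mod {u \<in> U. deg u = \<gamma>} :: ('g \<Rightarrow>\<^sub>0 'r) set"
  have zero: "Poly_Mapping.lookup (h \<gamma>) u = 0" if "\<And>\<gamma>. h \<gamma> \<in> ?M \<gamma>" "deg u \<noteq> \<gamma>" for h \<gamma> u
    using that by (fastforce simp: free_mod_def in_keys_iff)
  \<comment> \<open>At \<open>u\<close> only the component of index \<open>deg u\<close> can be
    nonzero, so the sum reduces to one term. Together with \<open>zero\<close> this gives both
    existence and uniqueness.\<close>
  have lookup_sum_fibres: "Poly_Mapping.lookup (\<Sum>\<gamma> | h \<gamma> \<noteq> 0. h \<gamma>) u =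
      Poly_Mapping.lookup (h (deg u)) u"
    if "finite {\<gamma>. h \<gamma> \<noteq> 0}" "\<And>\<gamma>. h \<gamma> \<in> ?M \<gamma>" for h u
  proof -
    have "(\<Sum>\<gamma> | h \<gamma> \<noteq> 0. Poly_Mapping.lookup (h \<gamma>) u) =
        (\<Sum>\<gamma> | h \<gamma> \<noteq> 0. if \<gamma> = deg u then Poly_Mapping.lookup (h \<gamma>) u else 0)"
      by (rule sum.cong) (use zero[OF that(2)] in auto)
    also have "\<dots> = Poly_Mapping.lookup (h (deg u)) u"
      using that(1) by (auto simp: sum.delta)
    finally show ?thesis by (simp add: lookup_sum)
  qed
  have "\<exists>!h. finite {\<gamma>. h \<gamma> \<noteq> 0} \<and> (\<forall>\<gamma>. h \<gamma> \<in> ?M \<gamma>) \<and> v = (\<Sum>\<gamma> | h \<gamma> \<noteq> 0. h \<gamma>)"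
    if v: "v \<in> free_mod U" for v
  proof (rule ex1I)
    define h where "h \<gamma> = (\<Sum>u | u \<in> Poly_Mapping.keys v \<and> deg u = \<gamma>.
      Poly_Mapping.single u (Poly_Mapping.lookup v u))" for \<gamma>
    have "{\<gamma>. h \<gamma> \<noteq> 0} \<subseteq> deg ` Poly_Mapping.keys v"
    proof
      fix \<gamma> assume "\<gamma> \<in> {\<gamma>. h \<gamma> \<noteq> 0}"
      then obtain u where "u \<in> {u. u \<in> Poly_Mapping.keys v \<and> deg u = \<gamma>}"
        unfolding h_def by (metis (mono_tags, lifting) mem_Collect_eq sum.neutral)
      then show "\<gamma> \<in> deg ` Poly_Mapping.keys v" by auto
    qed
    then have fin: "finite {\<gamma>. h \<gamma> \<noteq> 0}" by (rule finite_subset) simp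
    have mem: "h \<gamma> \<in> ?M \<gamma>" for \<gamma>
      unfolding h_def by (rule free_mod_sum) (use v in \<open>auto simp: free_mod_def\<close>)
    have "Poly_Mapping.lookup (h (deg u)) u = Poly_Mapping.lookup v u" for u
      unfolding h_def lookup_sum lookup_single when_def
      by (simp add: sum.delta in_keys_iff)
    then have "v = (\<Sum>\<gamma> | h \<gamma> \<noteq> 0. h \<gamma>)"
      by (intro poly_mapping_eqI) (simp add: lookup_sum_fibres[OF fin mem])
    then show "finite {\<gamma>. h \<gamma> \<noteq> 0} \<and> (\<forall>\<gamma>. h \<gamma> \<in> ?M \<gamma>) \<and> v = (\<Sum>\<gamma> | h \<gamma> \<noteq> 0. h \<gamma>)"
      using fin mem by blast
    fix k assume k: "finite {\<gamma>. k \<gamma> \<noteq> 0} \<and> (\<forall>\<gamma>. k \<gamma> \<in> ?M \<gamma>) \<and> v = (\<Sum>\<gamma> | k \<gamma> \<noteq> 0. k \<gamma>)"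
    show "k = h"
    proof (rule ext, rule poly_mapping_eqI)
      fix \<gamma> u
      show "Poly_Mapping.lookup (k \<gamma>) u = Poly_Mapping.lookup (h \<gamma>) u"
      proof (cases "deg u = \<gamma>")
        case True
        then show ?thesis
          using lookup_sum_fibres[of k u] lookup_sum_fibres[OF fin mem, of u] k
            \<open>v = (\<Sum>\<gamma> | h \<gamma> \<noteq> 0. h \<gamma>)\<close> by auto
      next
        case False
        then show ?thesis using zero[of k] zero[of h] k mem by simp
      qed
    qed
  qed
  moreover have "?M \<gamma> \<subseteq> free_mod U" for \<gamma>
    by (auto simp: free_mod_def)
  ultimately show ?thesis unfolding direct_sum_decomp_def by simp
qed

section \<open>Units, orbits and the action of a single bisection\<close>

context groupoid
begin

lemma arrow_comp_dom:
  assumes "x \<in> arrows G"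
  shows "(x, gdom G x) \<in> composable G" "gmult G x (gdom G x) = x"
proof -
  show "(x, gdom G x) \<in> composable G"
    unfolding gdom_def using assms assoc_right inv_composable inv_composable' by blast
  show "gmult G x (gdom G x) = x"
    using assms assoc[OF inv_composable' inv_composable, of x]
      cancel_right[OF inv_composable', of x]
    by (simp add: gdom_def inv_inv)
qed

lemma inv_dom_ran:
  assumes "x \<in> arrows G"
  shows "gdom G (ginv G x) = gran G x" "gran G (ginv G x) = gdom G x"
  using assms by (simp_all add: gdom_def gran_def inv_inv)

lemma unit_dom_ran:
  assumes "u \<in> units G"
  shows "u \<in> arrows G" "gdom G u = u" "gran G u = u"
proof -
  obtain x where x: "x \<in> arrows G" "u = gmult G (ginv G x) x"
    using assms by (auto simp: units_def gdom_def)
  note comp = inv_composable[OF x(1)]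
  show "u \<in> arrows G" using mult_closed[OF comp] x by simp
  show "gdom G u = u" using dom_mult[OF comp] x by (simp add: gdom_def)
  show "gran G u = u" using ran_mult[OF comp] inv_dom_ran[OF x(1)] x by (simp add: gdom_def)
qed

lemma ran_in_units: "x \<in> arrows G \<Longrightarrow> gran G x \<in> units G"
  unfolding units_def using inv_closed inv_dom_ran(1)[of x] by (metis image_eqI)

text \<open>If \<open>y\<close> leads from \<open>u\<close> to \<open>d x\<close>, then
  \<open>x y\<close> leads from \<open>u\<close> to \<open>r x\<close>; the unit \<open>u\<close> is
  itself an arrow from \<open>u\<close> to \<open>u\<close>.\<close>

lemma invariant_orbit:
  assumes "u \<in> units G"
  shows "invariant_set G (orbit_of G u)" "u \<in> orbit_of G u"
proof -
  show "u \<in> orbit_of G u"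
    unfolding orbit_of_def by (rule image_eqI[of _ _ u]) (use unit_dom_ran[OF assms] in auto)
  have "gran G x \<in> orbit_of G u" if x: "x \<in> arrows G" "gdom G x \<in> orbit_of G u" for x
  proof -
    obtain y where y: "y \<in> arrows G" "gdom G y = u" "gdom G x = gran G y"
      using x by (auto simp: orbit_of_def)
    then have comp: "(x, y) \<in> composable G" using x by (simp add: composable_iff)
    show ?thesis
      unfolding orbit_of_def
      by (rule image_eqI[of _ _ "gmult G x y"])
        (use ran_mult[OF comp] dom_mult[OF comp] mult_closed[OF comp] y in auto)
  qed
  then show "invariant_set G (orbit_of G u)"
    unfolding invariant_set_def using ran_in_units by (auto simp: orbit_of_def)
qed

lemma orbit_subset_invariant:
  "invariant_set G U \<Longrightarrow> u \<in> U \<Longrightarrow> orbit_of G u \<subseteq> U"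
  by (auto simp: invariant_set_def orbit_of_def)

lemma indicator_in_steinberg:
  assumes "compact_open_bisection G B"
  shows "(\<lambda>x. r * indicator B x) \<in> (steinberg_algebra G :: ('g \<Rightarrow> 'r::comm_ring_1) set)"
  unfolding steinberg_algebra_def
  by (rule CollectI, rule exI[of _ "{B}"], rule exI[of _ "\<lambda>_. r"])
    (use assms in \<open>simp del: sum_mult_indicator\<close>)

lemma indicator_in_steinberg':
  assumes "compact_open_bisection G B"
  shows "(indicator B :: 'g \<Rightarrow> 'r::comm_ring_1) \<in> steinberg_algebra G"
  using indicator_in_steinberg[OF assms, of 1] unfolding mult_1 .

text \<open>Injectivity of \<open>d\<close> on \<open>B\<close> leaves \<open>x\<close> as the only
  arrow of \<open>B\<close> with source \<open>d x\<close>, and disjointness makes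
  \<open>1_B\<close> annihilate every other basis element in the support of
  \<open>m\<close>.\<close>

lemma act_isolating_bisection:
  fixes m :: "'g \<Rightarrow>\<^sub>0 'r::comm_ring_1"
  assumes B: "compact_open_bisection G B" and x: "x \<in> B"
    and disj: "gdom G ` B \<inter> (Poly_Mapping.keys m - {gdom G x}) = {}"
  shows "act G (indicator B) m =
           Poly_Mapping.single (gran G x) (Poly_Mapping.lookup m (gdom G x))"
proof -
  note f = indicator_in_steinberg'[OF B, where 'r = 'r]
  have fib: "{y \<in> arrows G. gdom G y = u \<and> (indicator B y :: 'r) \<noteq> 0} = {y \<in> B. gdom G y = u}"
    for u
    using bisection_inj(1)[OF B] by (auto simp: indicator_def split: if_splits)
  have fib_x: "{y \<in> B. gdom G y = gdom G x} = {x}"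
    using bisection_inj(2)[OF B] x by (auto dest: inj_onD)
  have fib_other: "{y \<in> B. gdom G y = u} = {}" if "u \<in> Poly_Mapping.keys m - {gdom G x}" for u
    using disj that by auto
  \<comment> \<open>The index set is enlarged by \<open>gdom G x\<close>, which may lie outside the
    support of \<open>m\<close>; its term is then 0, matching the coefficient 0 in the
    claim.\<close>
  have "act G (indicator B) m =
      (\<Sum>u\<in>insert (gdom G x) (Poly_Mapping.keys m). \<Sum>y | y \<in> B \<and> gdom G y = u.
         Poly_Mapping.single (gran G y) (indicator B y * Poly_Mapping.lookup m u))"
    by (subst act_superset[OF f, of "insert (gdom G x) (Poly_Mapping.keys m)"])
      (auto simp only: fib finite_insert finite_keys)
  also have "\<dots> = (\<Sum>y\<in>{x}. Poly_Mapping.single (gran G y)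
      (indicator B y * Poly_Mapping.lookup m (gdom G x)))"
  proof -
    have "(\<Sum>u\<in>Poly_Mapping.keys m - {gdom G x}. \<Sum>y | y \<in> B \<and> gdom G y = u.
        Poly_Mapping.single (gran G y) (indicator B y * Poly_Mapping.lookup m u)) = 0"
      by (rule sum.neutral, rule ballI) (simp only: fib_other sum.empty)
    then show ?thesis unfolding sum.insert_remove[OF finite_keys] fib_x by simp
  qed
  finally show ?thesis using x by simp
qed

lemma submodule_free_mod:
  assumes "invariant_set G S" "S \<subseteq> U"
  shows "submodule G U (free_mod S :: ('g \<Rightarrow>\<^sub>0 'r::comm_ring_1) set)"
proof -
  let ?V = "free_mod S :: ('g \<Rightarrow>\<^sub>0 'r) set"
  have "v + w \<in> ?V" if "v \<in> ?V" "w \<in> ?V" for v w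
    using subspace_free_mod[of S] that unfolding module.subspace_def[OF module_rscale] by blast
  moreover have "?V \<subseteq> free_mod U" "0 \<in> ?V" "\<And>v. v \<in> ?V \<Longrightarrow> - v \<in> ?V"
    using assms(2) by (auto simp: free_mod_def)
  ultimately show ?thesis
    unfolding submodule_def by (simp add: act_free_mod[OF assms(1)])
qed

end

section \<open>Degrees and the extraction of single coefficients\<close>

locale graded_hausdorff_ample_groupoid = ample_groupoid G
  for G :: "'g groupoid_data" +
  fixes c :: "'g \<Rightarrow> 'c::group_add"
  assumes hausdorff: "Hausdorff_space (gtop G)"
    and grading: "groupoid_grading G c"
begin

lemma degree_mult: "(x, y) \<in> composable G \<Longrightarrow> c (gmult G x y) = c x + c y"
  using grading by (auto simp: groupoid_grading_def)

lemma degree_dom: "x \<in> arrows G \<Longrightarrow> c (gdom G x) = 0"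
  using degree_mult[OF arrow_comp_dom(1), of x] arrow_comp_dom(2)[of x]
  by (metis add.right_neutral add_left_imp_eq)

lemma degree_unit: "u \<in> units G \<Longrightarrow> c u = 0"
  using degree_dom unit_dom_ran by metis

lemma degree_inv:
  assumes "x \<in> arrows G"
  shows "c (ginv G x) = - c x"
proof -
  have "c (ginv G x) + c x = 0"
    using degree_mult[OF inv_composable[OF assms]] degree_dom[OF assms] by (simp add: gdom_def)
  then show ?thesis by (simp add: eq_neg_iff_add_eq_0)
qed

text \<open>Start from any compact open bisection around \<open>x\<close>. Removing the arrows with
  source in \<open>S\<close> keeps it open, because they form a finite and hence closed set by the
  Hausdorff property. Intersecting with the fibre of \<open>c\<close> keeps it open by continuity of
  \<open>c\<close> into a discrete group. The result need not be a compact open bisection, so the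
  basis is used once more to shrink it to one.\<close>

lemma isolating_bisection:
  assumes x: "x \<in> arrows G" and S: "finite S" "gdom G x \<notin> S"
  obtains B where "compact_open_bisection G B" "x \<in> B" "gdom G ` B \<inter> S = {}"
    "c ` B \<subseteq> {c x}"
proof -
  obtain B where B: "compact_open_bisection G B" "x \<in> B"
    using bisection_basis[OF openin_topspace] x unfolding arrows_def by blast
  have sub: "B \<subseteq> topspace (gtop G)" and inj: "inj_on (gdom G) B"
    using bisection_inj[OF B(1)] by (auto simp: arrows_def)
  define E where "E = {y \<in> B. gdom G y \<in> S}"
  have "finite E"
    by (rule inj_on_finite[of "gdom G" _ S]) (use inj S in \<open>auto simp: E_def inj_on_def\<close>)
  then have "closedin (gtop G) E"
    using closedin_Hausdorff_finite[OF hausdorff, of E] sub by (auto simp: E_def)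
  moreover have "openin (gtop G) {y \<in> topspace (gtop G). c y \<in> {c x}}"
    using grading openin_continuous_map_preimage[of "gtop G" "discrete_topology UNIV" c "{c x}"]
    by (auto simp: groupoid_grading_def)
  ultimately have "openin (gtop G) (B \<inter> {y \<in> topspace (gtop G). c y \<in> {c x}} - E)"
    using B(1) by (auto simp: compact_open_bisection_def intro!: openin_diff openin_Int)
  moreover have "x \<in> B \<inter> {y \<in> topspace (gtop G). c y \<in> {c x}} - E"
    using B(2) sub S(2) by (auto simp: E_def)
  ultimately obtain C where "compact_open_bisection G C" "x \<in> C"
    "C \<subseteq> B \<inter> {y \<in> topspace (gtop G). c y \<in> {c x}} - E"
    using bisection_basis by blast
  then show thesis by (intro that[of C]) (auto simp: E_def)
qed

text \<open>The function \<open>f\<close> depends on \<open>m\<close>: it is the indicator of a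
  bisection whose sources avoid the rest of the support of \<open>m\<close>. Its homogeneity matters
  for components of a grading; for submodules only its membership in the algebra does.\<close>

lemma transport:
  fixes m :: "'g \<Rightarrow>\<^sub>0 'r::comm_ring_1"
  assumes "x \<in> arrows G"
  obtains f where "f \<in> steinberg_component G c (c x)"
    "act G f m = Poly_Mapping.single (gran G x) (Poly_Mapping.lookup m (gdom G x))"
proof -
  obtain B where B: "compact_open_bisection G B" "x \<in> B"
    "gdom G ` B \<inter> (Poly_Mapping.keys m - {gdom G x}) = {}" "c ` B \<subseteq> {c x}"
    by (rule isolating_bisection[OF assms, of "Poly_Mapping.keys m - {gdom G x}"]) simp_all
  have "(indicator B :: 'g \<Rightarrow> 'r) \<in> steinberg_component G c (c x)"
    using indicator_in_steinberg'[OF B(1), where 'r = 'r] B(4) bisection_inj(1)[OF B(1)]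
    by (force simp: steinberg_component_def indicator_eq_0_iff)
  then show thesis using that act_isolating_bisection[OF B(1-3)] by blast
qed

lemma component_transport:
  assumes "module_grading G c U M" "m \<in> M \<gamma>" "x \<in> arrows G"
  shows "Poly_Mapping.single (gran G x) (Poly_Mapping.lookup m (gdom G x)) \<in> M (c x + \<gamma>)"
proof -
  obtain f where "f \<in> steinberg_component G c (c x)"
    "act G f m = Poly_Mapping.single (gran G x) (Poly_Mapping.lookup m (gdom G x))"
    using transport[OF assms(3)] .
  then show ?thesis using assms(1,2) by (metis module_grading_def)
qed

text \<open>A unit is an arrow of degree 0 from itself to itself, so transport along it does not
  leave the component.\<close>

lemma component_coefficient:
  assumes "module_grading G c U M" "m \<in> M \<gamma>" "u \<in> units G"
  shows "Poly_Mapping.single u (Poly_Mapping.lookup m u) \<in> M \<gamma>"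
  using component_transport[OF assms(1,2) unit_dom_ran(1)[OF assms(3)]] unit_dom_ran[OF assms(3)]
    degree_unit[OF assms(3)] by simp

lemma submodule_coefficient:
  assumes "submodule G U V" "v \<in> V" "x \<in> arrows G"
  shows "Poly_Mapping.single (gran G x) (Poly_Mapping.lookup v (gdom G x)) \<in> V"
proof -
  obtain f where "f \<in> steinberg_component G c (c x)"
    "act G f v = Poly_Mapping.single (gran G x) (Poly_Mapping.lookup v (gdom G x))"
    using transport[OF assms(3)] .
  then show ?thesis using assms(1,2) by (force simp: submodule_def steinberg_component_def)
qed

section \<open>Consequences of a grading of \<open>RU\<close>\<close>

lemma module_grading_zero: "module_grading G c U M \<Longrightarrow> 0 \<in> M \<gamma>"
  by (simp add: module_grading_def module.subspace_def[OF module_rscale])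

lemma graded_imp_aperiodic:
  assumes U: "U \<subseteq> units G" and "graded_module G c U TYPE('r::comm_ring_1)"
  shows "aperiodic_set G c U"
proof -
  obtain M :: "'c \<Rightarrow> ('g \<Rightarrow>\<^sub>0 'r) set" where M: "module_grading G c U M"
    using assms(2) by (auto simp: graded_module_def)
  then have ds: "direct_sum_decomp (free_mod U) M" by (simp add: module_grading_def)
  have "c x = 0" if u: "u \<in> U" and x: "x \<in> arrows G" "gdom G x = u" "gran G x = u" for u x
  proof (rule ccontr)
    assume "c x \<noteq> 0"
    have "Poly_Mapping.single u (1::'r) \<in> free_mod U" using u by simp
    then obtain h where h: "\<And>\<gamma>. h \<gamma> \<in> M \<gamma>"
        "Poly_Mapping.single u (1::'r) = (\<Sum>\<gamma> | h \<gamma> \<noteq> 0. h \<gamma>)"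
      using ds unfolding direct_sum_decomp_def by blast
    \<comment> \<open>The basis element \<open>u\<close> need not be homogeneous, but the
      coefficients at \<open>u\<close> of its components add up to 1, so one of them is
      nonzero.\<close>
    have "(\<Sum>\<gamma> | h \<gamma> \<noteq> 0. Poly_Mapping.lookup (h \<gamma>) u) = 1"
      unfolding lookup_sum[symmetric] h(2)[symmetric] by simp
    then obtain \<gamma> where \<gamma>: "Poly_Mapping.lookup (h \<gamma>) u \<noteq> 0"
      by (metis sum.neutral zero_neq_one)
    let ?v = "Poly_Mapping.single u (Poly_Mapping.lookup (h \<gamma>) u)"
    have "?v \<in> M \<gamma>" using component_coefficient[OF M h(1)] u U by blast
    moreover have "?v \<in> M (c x + \<gamma>)" using component_transport[OF M h(1) x(1)] x by simp
    \<comment> \<open>Right cancellation in the group gives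
      \<open>c x + \<gamma> \<noteq> \<gamma>\<close>, so \<open>?v\<close> lies in two different
      components.\<close>
    ultimately have "?v = 0"
      using direct_sum_disjoint[OF ds module_grading_zero[OF M], of ?v \<gamma> "c x + \<gamma>"] \<open>c x \<noteq> 0\<close>
        add_right_imp_eq[of 0 \<gamma> "c x"]
      by auto
    then show False using \<gamma> by (metis lookup_single_eq lookup_zero)
  qed
  then show ?thesis by (auto simp: aperiodic_set_def aperiodic_unit_def Iso_def)
qed

text \<open>It suffices that the homogeneous components in \<open>RU\<close> of an element of
  \<open>free_mod S\<close> have no coefficients outside \<open>S\<close>. Uniqueness is then
  inherited from \<open>RU\<close>.\<close>

lemma graded_subset_free_mod:
  fixes M :: "'c \<Rightarrow> ('g \<Rightarrow>\<^sub>0 'r::comm_ring_1) set"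
  assumes U: "U \<subseteq> units G" and M: "module_grading G c U M" and S: "S \<subseteq> U"
  shows "graded_subset M (free_mod S)"
proof -
  have ds: "direct_sum_decomp (free_mod U) M" using M by (simp add: module_grading_def)
  have "\<exists>!h. finite {\<gamma>. h \<gamma> \<noteq> 0} \<and> (\<forall>\<gamma>. h \<gamma> \<in> free_mod S \<inter> M \<gamma>) \<and> v = (\<Sum>\<gamma> | h \<gamma> \<noteq> 0. h \<gamma>)"
    if v: "v \<in> free_mod S" for v
  proof -
    have vU: "v \<in> free_mod U" using v S by (auto simp: free_mod_def)
    then obtain h where h: "finite {\<gamma>. h \<gamma> \<noteq> 0}" "\<And>\<gamma>. h \<gamma> \<in> M \<gamma>" "v = (\<Sum>\<gamma> | h \<gamma> \<noteq> 0. h \<gamma>)"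
      using ds unfolding direct_sum_decomp_def by blast
    have off_S: "Poly_Mapping.lookup (h \<gamma>) w = 0" if w: "w \<in> U" "w \<notin> S" for w \<gamma>
    proof -
      \<comment> \<open>The \<open>w\<close>-parts of the components are again homogeneous of the
        same degrees, and they add up to the \<open>w\<close>-part of \<open>v\<close>, which is 0.
        Uniqueness of the decomposition of 0 makes each of them vanish.\<close>
      define k where "k \<gamma> = Poly_Mapping.single w (Poly_Mapping.lookup (h \<gamma>) w)" for \<gamma>
      have kM: "k \<gamma> \<in> M \<gamma>" for \<gamma>
        unfolding k_def using component_coefficient[OF M h(2)] w U by blast
      have sub: "{\<gamma>. k \<gamma> \<noteq> 0} \<subseteq> {\<gamma>. h \<gamma> \<noteq> 0}" by (auto simp: k_def)
      have "(\<Sum>\<gamma> | k \<gamma> \<noteq> 0. k \<gamma>) = (\<Sum>\<gamma> | h \<gamma> \<noteq> 0. k \<gamma>)"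
        by (rule sum.mono_neutral_left) (use sub h(1) in auto)
      also have "\<dots> = Poly_Mapping.single w (Poly_Mapping.lookup v w)"
        unfolding h(3) k_def by (rule poly_mapping_eqI) (auto simp: lookup_sum lookup_single when_def)
      also have "Poly_Mapping.lookup v w = 0"
        using v w(2) by (auto simp: free_mod_def in_keys_iff)
      finally have "k = (\<lambda>_. 0)"
        by (intro direct_sum_unique[OF ds, of 0])
          (use kM finite_subset[OF sub h(1)] module_grading_zero[OF M] in \<open>auto simp: free_mod_def\<close>)
      then show ?thesis by (metis k_def lookup_single_eq lookup_zero)
    qed
    have "h \<gamma> \<in> free_mod S" for \<gamma>
    proof -
      have "h \<gamma> \<in> free_mod U" using h(2) ds by (auto simp: direct_sum_decomp_def)
      then show ?thesis using off_S by (fastforce simp: free_mod_def in_keys_iff)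
    qed
    then show ?thesis using h direct_sum_unique[OF ds vU] by (intro ex1I[of _ h]) auto
  qed
  then show ?thesis unfolding graded_subset_def direct_sum_decomp_def by auto
qed

lemma graded_basic_simple_imp_orbit:
  assumes U: "invariant_set G U" and simple: "graded_basic_simple G c U TYPE('r::comm_ring_1)"
  shows "is_orbit G U"
proof -
  obtain M :: "'c \<Rightarrow> ('g \<Rightarrow>\<^sub>0 'r) set" where M: "module_grading G c U M"
    and only: "\<And>V. basic_submodule G U V \<Longrightarrow> graded_subset M V \<Longrightarrow> V = {0} \<or> V = free_mod U"
    and nz: "(free_mod U :: ('g \<Rightarrow>\<^sub>0 'r) set) \<noteq> {0}"
    using simple by (auto simp: graded_basic_simple_def)
  have units: "U \<subseteq> units G" using U by (simp add: invariant_set_def)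
  obtain u where u: "u \<in> U" using nz unfolding free_mod_eq_0_iff ex_in_conv[symmetric] ..
  then have u_unit: "u \<in> units G" using units by blast
  let ?O = "orbit_of G u"
  note inv = invariant_orbit[OF u_unit]
  have sub: "?O \<subseteq> U" by (rule orbit_subset_invariant[OF U u])
  \<comment> \<open>Basicness is immediate, since a nonzero multiple of a basis element has that
    element as its support.\<close>
  have "basic_submodule G U (free_mod ?O :: ('g \<Rightarrow>\<^sub>0 'r) set)"
    unfolding basic_submodule_def using submodule_free_mod[OF inv(1) sub] by auto
  then have "(free_mod ?O :: ('g \<Rightarrow>\<^sub>0 'r) set) = {0} \<or> (free_mod ?O :: ('g \<Rightarrow>\<^sub>0 'r) set) = free_mod U"
    using only graded_subset_free_mod[OF units M sub] by blast
  moreover have "(free_mod ?O :: ('g \<Rightarrow>\<^sub>0 'r) set) \<noteq> {0}"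
    using inv(2) unfolding free_mod_eq_0_iff by (metis empty_iff)
  ultimately have "(free_mod U :: ('g \<Rightarrow>\<^sub>0 'r) set) \<subseteq> free_mod ?O" by simp
  then have "U \<subseteq> ?O" by (rule free_mod_subsetD)
  then have "U = ?O" using sub by (rule equalityI)
  then show ?thesis unfolding is_orbit_def by (rule bexI[OF _ u_unit])
qed

section \<open>Grading and basic simplicity on orbits\<close>

lemma aperiodic_orbit_imp_graded:
  assumes orbit: "is_orbit G U" and aper: "aperiodic_set G c U"
  shows "graded_module G c U TYPE('r::comm_ring_1)"
proof -
  obtain u0 where u0: "u0 \<in> units G" "U = orbit_of G u0"
    using orbit by (auto simp: is_orbit_def)
  have inv: "invariant_set G U" and "u0 \<in> U" using invariant_orbit[OF u0(1)] u0(2) by simp_all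
  then have aper0: "c x = 0" if "x \<in> arrows G" "gdom G x = u0" "gran G x = u0" for x
    using aper that by (auto simp: aperiodic_set_def aperiodic_unit_def Iso_def)
  have same_degree: "c x = c y"
    if "x \<in> arrows G" "y \<in> arrows G" "gdom G x = u0" "gdom G y = u0" "gran G x = gran G y" for x y
  proof -
    \<comment> \<open>Going along \<open>y\<close> and back along \<open>x\<close> is an isotropy
      arrow at \<open>u0\<close>, hence of degree 0.\<close>
    have comp: "(ginv G x, y) \<in> composable G"
      using that by (simp add: composable_iff inv_closed inv_dom_ran)
    have "c (gmult G (ginv G x) y) = 0"
      by (rule aper0)
        (use that mult_closed[OF comp] dom_mult[OF comp] ran_mult[OF comp] inv_dom_ran in auto)
    then have "- c x + c y = 0" using degree_mult[OF comp] degree_inv[OF that(1)] by simp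
    then show ?thesis by (metis add.inverse_inverse minus_unique)
  qed
  have "\<exists>a. a \<in> arrows G \<and> gdom G a = u0 \<and> gran G a = u" if "u \<in> U" for u
    using that u0(2) by (auto simp: orbit_of_def)
  then obtain a where a: "\<And>u. u \<in> U \<Longrightarrow> a u \<in> arrows G \<and> gdom G (a u) = u0 \<and> gran G (a u) = u"
    by metis
  \<comment> \<open>By \<open>same_degree\<close>, this value is independent of the arrow chosen
    from \<open>u0\<close> to \<open>u\<close>.\<close>
  define deg where "deg u = c (a u)" for u
  have deg: "deg (gran G x) = c x + deg (gdom G x)" if x: "x \<in> arrows G" "gdom G x \<in> U" for x
  proof -
    have r: "gran G x \<in> U" using inv x by (simp add: invariant_set_def)
    \<comment> \<open>The product of \<open>x\<close> with \<open>a (gdom G x)\<close> is a second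
      arrow from \<open>u0\<close> to \<open>gran G x\<close>, so it has the degree of
      \<open>a (gran G x)\<close>.\<close>
    have comp: "(x, a (gdom G x)) \<in> composable G" using x a by (simp add: composable_iff)
    have "c (a (gran G x)) = c (gmult G x (a (gdom G x)))"
      by (rule same_degree)
        (use x r a mult_closed[OF comp] dom_mult[OF comp] ran_mult[OF comp] in auto)
    then show ?thesis using degree_mult[OF comp] by (simp add: deg_def)
  qed
  let ?M = "\<lambda>\<gamma>. free_mod {u \<in> U. deg u = \<gamma>} :: ('g \<Rightarrow>\<^sub>0 'r) set"
  \<comment> \<open>Each arrow in the support of \<open>f\<close> has degree
    \<open>\<alpha>\<close>, so by \<open>deg\<close> it moves basis elements of degree
    \<open>\<gamma>\<close> to degree \<open>\<alpha> + \<gamma>\<close>.\<close>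
  have "act G f m \<in> ?M (\<alpha> + \<gamma>)" if f: "f \<in> steinberg_component G c \<alpha>" and m: "m \<in> ?M \<gamma>" for f m \<alpha> \<gamma>
    unfolding act_def
  proof (intro free_mod_sum)
    fix u x assume u: "u \<in> Poly_Mapping.keys m"
      and x: "x \<in> {x \<in> arrows G. gdom G x = u \<and> f x \<noteq> 0}"
    then have "u \<in> U" "deg u = \<gamma>" "c x = \<alpha>" "gran G x \<in> U"
      using f m inv by (auto simp: free_mod_def steinberg_component_def invariant_set_def)
    then show "Poly_Mapping.single (gran G x) (f x * Poly_Mapping.lookup m u) \<in> ?M (\<alpha> + \<gamma>)"
      using deg[of x] x by simp
  qed
  then have "module_grading G c U ?M"
    unfolding module_grading_def using subspace_free_mod direct_sum_free_mod_fibres by blast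
  then show ?thesis unfolding graded_module_def by blast
qed

text \<open>A nonzero coefficient of an element of \<open>V\<close> is isolated and carried to the
  base point \<open>u0\<close>, basicness replaces it by 1, and arrows out of \<open>u0\<close> then
  reach every basis element.\<close>

lemma orbit_imp_basic_simple:
  assumes "is_orbit G U"
  shows "basic_simple G U TYPE('r::comm_ring_1)"
proof -
  obtain u0 where u0: "u0 \<in> units G" "U = orbit_of G u0"
    using assms by (auto simp: is_orbit_def)
  have inv: "invariant_set G U" and u0U: "u0 \<in> U" using invariant_orbit[OF u0(1)] u0(2) by simp_all
  have "V = free_mod U" if V: "basic_submodule G U V" and "V \<noteq> {0}" for V :: "('g \<Rightarrow>\<^sub>0 'r) set"
  proof -
    have sub: "submodule G U V"
      and basic: "\<And>r u. r \<noteq> 0 \<Longrightarrow> u \<in> U \<Longrightarrow> Poly_Mapping.single u r \<in> V \<Longrightarrow> Poly_Mapping.single u 1 \<in> V"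
      using V by (auto simp: basic_submodule_def)
    have VU: "V \<subseteq> free_mod U" and V0: "0 \<in> V" and Vadd: "\<And>v w. v \<in> V \<Longrightarrow> w \<in> V \<Longrightarrow> v + w \<in> V"
      and Vact: "\<And>f v. f \<in> steinberg_algebra G \<Longrightarrow> v \<in> V \<Longrightarrow> act G f v \<in> V"
      using sub by (auto simp: submodule_def)
    obtain v where v: "v \<in> V" "v \<noteq> 0" using \<open>V \<noteq> {0}\<close> V0 by blast
    then obtain u where u: "u \<in> Poly_Mapping.keys v" by (metis ex_in_conv keys_eq_empty)
    then have uU: "u \<in> U" using VU v by (auto simp: free_mod_def)
    obtain y where y: "y \<in> arrows G" "gdom G y = u0" "gran G y = u"
      using uU u0(2) by (auto simp: orbit_of_def)
    \<comment> \<open>Transport runs along the inverse of \<open>y\<close>, which leads from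
      \<open>u\<close> back to \<open>u0\<close>.\<close>
    have "Poly_Mapping.single u0 (Poly_Mapping.lookup v u) \<in> V"
      using submodule_coefficient[OF sub v(1) inv_closed[OF y(1)]] inv_dom_ran[OF y(1)] y by simp
    then have u0V: "Poly_Mapping.single u0 1 \<in> V"
      using basic u u0U by (simp add: in_keys_iff)
    \<comment> \<open>Closure of \<open>V\<close> under scalars is not part of
      \<open>submodule\<close>; the factor \<open>r\<close> is obtained by acting with
      \<open>r 1_B\<close>, which is an element of the algebra.\<close>
    have single: "Poly_Mapping.single w r \<in> V" if w: "w \<in> U" for w r
    proof -
      obtain x where x: "x \<in> arrows G" "gdom G x = u0" "gran G x = w"
        using w u0(2) by (auto simp: orbit_of_def)
      obtain B where B: "compact_open_bisection G B" "x \<in> B"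
        by (rule isolating_bisection[OF x(1), of "{}"]) simp_all
      have "act G (\<lambda>z. r * indicator B z) (Poly_Mapping.single u0 1) =
          rscale r (Poly_Mapping.single w 1)"
        unfolding act_scale_left[OF indicator_in_steinberg'[OF B(1)]]
          act_bisection(1)[OF B x(2)] x(3) ..
      also have "\<dots> = Poly_Mapping.single w r"
        by (rule poly_mapping_eqI) (simp add: lookup_single when_def)
      finally show ?thesis using Vact[OF indicator_in_steinberg[OF B(1)] u0V] by metis
    qed
    have Vsum: "sum h A \<in> V" if "\<And>i. i \<in> A \<Longrightarrow> h i \<in> V" for A :: "'g set" and h
      using that by (induction A rule: infinite_finite_induct) (auto simp: V0 Vadd)
    have "m \<in> V" if "m \<in> free_mod U" for m
    proof -
      have "(\<Sum>w\<in>Poly_Mapping.keys m. Poly_Mapping.single w (Poly_Mapping.lookup m w)) \<in> V"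
        by (rule Vsum, rule single) (use that in \<open>auto simp: free_mod_def\<close>)
      moreover have "(\<Sum>w\<in>Poly_Mapping.keys m. Poly_Mapping.single w (Poly_Mapping.lookup m w)) = m"
        by (rule poly_mapping_eqI) (simp add: lookup_sum lookup_single when_def sum.delta in_keys_iff)
      ultimately show ?thesis by simp
    qed
    then show ?thesis using VU by blast
  qed
  moreover have "(free_mod U :: ('g \<Rightarrow>\<^sub>0 'r) set) \<noteq> {0}"
    using u0U unfolding free_mod_eq_0_iff by (metis empty_iff)
  ultimately show ?thesis unfolding basic_simple_def by blast
qed

end

theorem theorem7p5:
  fixes G :: "'g groupoid_data"
    and c :: "'g \<Rightarrow> 'c::group_add"
    and U :: "'g set"
  assumes "ample_groupoid G"
    and "Hausdorff_space (gtop G)"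
    and "groupoid_grading G c"
    and "invariant_set G U"
  shows "(is_orbit G U \<and> aperiodic_set G c U \<longleftrightarrow>
            graded_basic_simple G c U TYPE('r::comm_ring_1)) \<and>
         (graded_basic_simple G c U TYPE('r) \<longleftrightarrow>
            graded_module G c U TYPE('r) \<and> basic_simple G U TYPE('r))"
proof -
  interpret graded_hausdorff_ample_groupoid G c
    using assms(1-3)
    by (simp add: graded_hausdorff_ample_groupoid_def graded_hausdorff_ample_groupoid_axioms_def)
  \<comment> \<open>Both equivalences follow from a cycle: graded basic simple implies aperiodic
    orbit, which implies graded and basic simple, which implies graded basic simple.\<close>
  have "is_orbit G U \<and> aperiodic_set G c U" if simple: "graded_basic_simple G c U TYPE('r)"
  proof
    show "is_orbit G U" using graded_basic_simple_imp_orbit[OF assms(4) simple] .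
    have "graded_module G c U TYPE('r)"
      using simple by (auto simp: graded_basic_simple_def graded_module_def)
    moreover have "U \<subseteq> units G" using assms(4) by (simp add: invariant_set_def)
    ultimately show "aperiodic_set G c U" by (rule graded_imp_aperiodic[rotated])
  qed
  moreover have "graded_module G c U TYPE('r) \<and> basic_simple G U TYPE('r)"
    if "is_orbit G U \<and> aperiodic_set G c U"
    using that aperiodic_orbit_imp_graded orbit_imp_basic_simple by blast
  \<comment> \<open>Any grading serves as witness, since graded basic submodules are in particular
    basic submodules.\<close>
  moreover have "graded_basic_simple G c U TYPE('r)"
    if "graded_module G c U TYPE('r) \<and> basic_simple G U TYPE('r)"
    using that unfolding graded_module_def basic_simple_def graded_basic_simple_def by blast
  ultimately show ?thesis by blast
qed

end
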